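(* For all data $\alpha,\beta$: if $\alpha\vDash\beta$ then there exists a quasi-normal deduction of $\beta$ from $\alpha$ in the Data Calculus DC; indeed there exists one in which the rule Exp is not used in the quasi-analytic part.
   Context: Formulas are those of classical propositional logic, built from propositional variables with $\neg,\wedge,\vee$. A datum is a finite set of finite sets of formulas; its elements are called components. Notation: $\Gamma,A$ is $\Gamma\cup\{A\}$; $\Gamma,\Delta$ is $\Gamma\cup\Delta$; $\Gamma/\rho$ is $\{\Gamma\}\cup\rho$ and $\Gamma/\Delta/\rho$ is $\{\Gamma,\Delta\}\cup\rho$, where $\rho$ is any datum (possibly empty, overlaps allowed). An interpretation (assignment of truth-values to the variables) verifies a datum if it verifies every formula of at least one component. $\alpha\vDash\beta$ means that every interpretation verifying $\alpha$ verifies $\beta$. Rules of the Data Calculus (DC). G-rules (each line is a pair of rules: the analytic rule infers the right side from the left side, the synthetic rule infers the left side from the right side): $\Gamma,A\wedge B/\rho$ and $\Gamma,A,B/\rho$; $\Gamma,A\vee B/\rho$ and $\Gamma,A/\Gamma,B/\rho$; $\Gamma,\neg\neg A/\rho$ and $\Gamma,A/\rho$; $\Gamma,\neg(A\vee B)/\rho$ and $\Gamma,\neg A,\neg B/\rho$; $\Gamma,\neg(A\wedge B)/\rho$ and $\Gamma,\neg A/\Gamma,\neg B/\rho$. N-rules: NC (analytic): from $\Gamma,A,\neg A/\rho$ infer $\rho$. EM (synthetic): from $\Gamma/\rho$ infer $\Gamma,A/\Gamma,\neg A/\rho$. S-rules: Del (analytic): from $\Gamma,\Delta/\rho$ infer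 $\Gamma/\rho$. Exp (synthetic): from $\rho$ infer $\Gamma/\rho$. A deduction of $\beta$ from $\alpha$ is a finite sequence of data starting with $\alpha$ and ending with $\beta$ in which each datum after the first is inferable from the immediately preceding one by one of the rules. A deduction is quasi-analytic (resp. quasi-synthetic) if every step is licensed either by an analytic (resp. synthetic) rule or by an S-rule. A deduction is quasi-normal if it consists of a quasi-analytic part followed by a quasi-synthetic part (either part may be empty). *)

theory Defs
  imports Main "HOL-Library.FSet"
begin

datatype 'v form =
    Var 'v
  | Neg "'v form"
  | Con "'v form" "'v form"
  | Dis "'v form" "'v form"

type_synonym 'v datum = "'v form fset fset"

primrec verifies_form :: "('v \<Rightarrow> bool) \<Rightarrow> 'v form \<Rightarrow> bool" where
  "verifies_form I (Var p) \<longleftrightarrow> I p"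
| "verifies_form I (Neg A) \<longleftrightarrow> \<not> verifies_form I A"
| "verifies_form I (Con A B) \<longleftrightarrow> verifies_form I A \<and> verifies_form I B"
| "verifies_form I (Dis A B) \<longleftrightarrow> verifies_form I A \<or> verifies_form I B"

definition verifies :: "('v \<Rightarrow> bool) \<Rightarrow> 'v datum \<Rightarrow> bool" where
  "verifies I \<alpha> \<longleftrightarrow> (\<exists>\<Gamma>. \<Gamma> |\<in>| \<alpha> \<and> (\<forall>A. A |\<in>| \<Gamma> \<longrightarrow> verifies_form I A))"

definition entails :: "'v datum \<Rightarrow> 'v datum \<Rightarrow> bool" where
  "entails \<alpha> \<beta> \<longleftrightarrow> (\<forall>I. verifies I \<alpha> \<longrightarrow> verifies I \<beta>)"

datatype g_kind = GCon | GDis | GNegNeg | GNegDis | GNegCon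

text \<open>\<open>g_pair k \<alpha> \<beta>\<close> relates the left side \<open>\<alpha>\<close> of the pair of G-rules of kind \<open>k\<close> to its
  right side \<open>\<beta>\<close>. Overlaps are allowed: the principal formula may already belong to \<open>\<Gamma>\<close>, and the
  displayed components may already belong to \<open>\<rho>\<close>.\<close>

inductive g_pair :: "g_kind \<Rightarrow> 'v datum \<Rightarrow> 'v datum \<Rightarrow> bool" where
  "g_pair GCon (finsert (finsert (Con A B) \<Gamma>) \<rho>)
               (finsert (finsert A (finsert B \<Gamma>)) \<rho>)"
| "g_pair GDis (finsert (finsert (Dis A B) \<Gamma>) \<rho>)
               (finsert (finsert A \<Gamma>) (finsert (finsert B \<Gamma>) \<rho>))"
| "g_pair GNegNeg (finsert (finsert (Neg (Neg A)) \<Gamma>) \<rho>)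
                  (finsert (finsert A \<Gamma>) \<rho>)"
| "g_pair GNegDis (finsert (finsert (Neg (Dis A B)) \<Gamma>) \<rho>)
                  (finsert (finsert (Neg A) (finsert (Neg B) \<Gamma>)) \<rho>)"
| "g_pair GNegCon (finsert (finsert (Neg (Con A B)) \<Gamma>) \<rho>)
                  (finsert (finsert (Neg A) \<Gamma>) (finsert (finsert (Neg B) \<Gamma>) \<rho>))"

datatype dc_rule = GAna g_kind | GSyn g_kind | NC | EM | Del | Exp

text \<open>\<open>infers r \<alpha> \<beta>\<close>: the datum \<open>\<beta>\<close> is inferable from \<open>\<alpha>\<close> by the rule \<open>r\<close>.\<close>

inductive infers :: "dc_rule \<Rightarrow> 'v datum \<Rightarrow> 'v datum \<Rightarrow> bool" where
  "g_pair k \<alpha> \<beta> \<Longrightarrow> infers (GAna k) \<alpha> \<beta>"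
| "g_pair k \<alpha> \<beta> \<Longrightarrow> infers (GSyn k) \<beta> \<alpha>"
| "infers NC (finsert (finsert A (finsert (Neg A) \<Gamma>)) \<rho>) \<rho>"
| "infers EM (finsert \<Gamma> \<rho>) (finsert (finsert A \<Gamma>) (finsert (finsert (Neg A) \<Gamma>) \<rho>))"
| "infers Del (finsert (\<Gamma> |\<union>| \<Delta>) \<rho>) (finsert \<Gamma> \<rho>)"
| "infers Exp \<rho> (finsert \<Gamma> \<rho>)"

definition analytic_rules :: "dc_rule set" where
  "analytic_rules = range GAna \<union> {NC, Del}"

definition synthetic_rules :: "dc_rule set" where
  "synthetic_rules = range GSyn \<union> {EM, Exp}"

definition S_rules :: "dc_rule set" where
  "S_rules = {Del, Exp}"

text \<open>A step may be an instance of several rules at once; \<open>licensed_by R ds\<close> says that every step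
  of \<open>ds\<close> is an instance of at least one rule in \<open>R\<close>.\<close>

definition licensed_by :: "dc_rule set \<Rightarrow> 'v datum list \<Rightarrow> bool" where
  "licensed_by R ds \<longleftrightarrow> successively (\<lambda>\<alpha> \<beta>. \<exists>r\<in>R. infers r \<alpha> \<beta>) ds"

definition deduction :: "'v datum \<Rightarrow> 'v datum list \<Rightarrow> 'v datum \<Rightarrow> bool" where
  "deduction \<alpha> ds \<beta> \<longleftrightarrow> ds \<noteq> [] \<and> hd ds = \<alpha> \<and> last ds = \<beta> \<and> licensed_by UNIV ds"

definition quasi_analytic :: "'v datum list \<Rightarrow> bool" where
  "quasi_analytic ds \<longleftrightarrow> licensed_by (analytic_rules \<union> S_rules) ds"

definition quasi_synthetic :: "'v datum list \<Rightarrow> bool" where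
  "quasi_synthetic ds \<longleftrightarrow> licensed_by (synthetic_rules \<union> S_rules) ds"

text \<open>The two parts share the datum \<open>\<gamma>\<close> at which they meet; a part without steps is the
  one-element sequence consisting of \<open>\<gamma>\<close> alone.\<close>

definition quasi_normal :: "'v datum list \<Rightarrow> bool" where
  "quasi_normal ds \<longleftrightarrow>
     (\<exists>xs \<gamma> ys. ds = xs @ \<gamma> # ys \<and> quasi_analytic (xs @ [\<gamma>]) \<and> quasi_synthetic (\<gamma> # ys))"

definition quasi_normal_without_Exp :: "'v datum list \<Rightarrow> bool" where
  "quasi_normal_without_Exp ds \<longleftrightarrow>
     (\<exists>xs \<gamma> ys. ds = xs @ \<gamma> # ys \<and>
        licensed_by ((analytic_rules \<union> S_rules) - {Exp}) (xs @ [\<gamma>]) \<and> quasi_synthetic (\<gamma> # ys))"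

end

theory Submission
  imports Defs
begin

text \<open>Analytic steps turn \<open>\<alpha>\<close> into a datum of consistent sets of literals. In the synthetic part,
  \<open>Exp\<close> first adjoins all components of \<open>\<beta>\<close>, and then the literal components are absorbed one at
  a time: EM splits such a component until it decides every variable of \<open>\<beta>\<close>, so that it describes
  an interpretation verifying some component \<open>\<Delta>\<close> of \<open>\<beta>\<close>; the formulas of \<open>\<Delta>\<close> can then be
  synthesised from the literals, and Del leaves \<open>\<Delta>\<close>, which is already present.\<close>

section \<open>Single steps of the two parts of a quasi-normal deduction\<close>

definition analytic_step :: "'v datum \<Rightarrow> 'v datum \<Rightarrow> bool" where
  "analytic_step \<alpha> \<beta> \<longleftrightarrow> (\<exists>r \<in> (analytic_rules \<union> S_rules) - {Exp}. infers r \<alpha> \<beta>)"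

definition synthetic_step :: "'v datum \<Rightarrow> 'v datum \<Rightarrow> bool" where
  "synthetic_step \<alpha> \<beta> \<longleftrightarrow> (\<exists>r \<in> synthetic_rules \<union> S_rules. infers r \<alpha> \<beta>)"

lemma analytic_step_G: "g_pair k \<alpha> \<beta> \<Longrightarrow> analytic_step \<alpha> \<beta>"
  unfolding analytic_step_def
  by (rule bexI[of _ "GAna k"]) (auto simp: analytic_rules_def intro: infers.intros)

lemma analytic_step_NC: "analytic_step (finsert (finsert A (finsert (Neg A) \<Gamma>)) \<rho>) \<rho>"
  unfolding analytic_step_def
  by (rule bexI[of _ NC]) (auto simp: analytic_rules_def intro: infers.intros)

lemma synthetic_step_G: "g_pair k \<alpha> \<beta> \<Longrightarrow> synthetic_step \<beta> \<alpha>"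
  unfolding synthetic_step_def
  by (rule bexI[of _ "GSyn k"]) (auto simp: synthetic_rules_def intro: infers.intros)

lemma synthetic_step_EM:
  "synthetic_step (finsert \<Gamma> \<rho>) (finsert (finsert A \<Gamma>) (finsert (finsert (Neg A) \<Gamma>) \<rho>))"
  unfolding synthetic_step_def
  by (rule bexI[of _ EM]) (auto simp: synthetic_rules_def intro: infers.intros)

lemma synthetic_step_Exp: "synthetic_step \<rho> (finsert \<Gamma> \<rho>)"
  unfolding synthetic_step_def
  by (rule bexI[of _ Exp]) (auto simp: synthetic_rules_def intro: infers.intros)

lemma synthetic_step_Del: "synthetic_step (finsert (\<Gamma> |\<union>| \<Delta>) \<rho>) (finsert \<Gamma> \<rho>)"
  unfolding synthetic_step_def
  by (rule bexI[of _ Del]) (auto simp: S_rules_def intro: infers.intros)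

lemma entails_trans: "entails \<alpha> \<beta> \<Longrightarrow> entails \<beta> \<gamma> \<Longrightarrow> entails \<alpha> \<gamma>"
  by (auto simp: entails_def)

lemma entails_singleton_mono: "\<Gamma> |\<subseteq>| \<Delta> \<Longrightarrow> entails {|\<Delta>|} {|\<Gamma>|}"
  by (auto simp: entails_def verifies_def)

section \<open>Analysis of a datum into consistent sets of literals\<close>

fun literal :: "'v form \<Rightarrow> bool" where
  "literal (Var p) = True"
| "literal (Neg (Var p)) = True"
| "literal _ = False"

definition consistent_literals :: "'v form fset \<Rightarrow> bool" where
  "consistent_literals \<Gamma> \<longleftrightarrow>
     (\<forall>A. A |\<in>| \<Gamma> \<longrightarrow> literal A) \<and> (\<forall>p. \<not> (Var p |\<in>| \<Gamma> \<and> Neg (Var p) |\<in>| \<Gamma>))"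

text \<open>Binary connectives weigh 2 so that \<open>Neg (Dis A B)\<close> outweighs \<open>Neg A\<close> and \<open>Neg B\<close> together.\<close>

primrec weight :: "'v form \<Rightarrow> nat" where
  "weight (Var p) = 0"
| "weight (Neg A) = weight A + 1"
| "weight (Con A B) = weight A + weight B + 2"
| "weight (Dis A B) = weight A + weight B + 2"

definition weights :: "'v form fset \<Rightarrow> nat" where
  "weights \<Gamma> = sum weight (fset \<Gamma>)"

lemma weights_finsert: "A |\<notin>| \<Gamma> \<Longrightarrow> weights (finsert A \<Gamma>) = weight A + weights \<Gamma>"
  by (simp add: weights_def)

lemma weights_finsert_le: "weights (finsert A \<Gamma>) \<le> weight A + weights \<Gamma>"
  by (cases "A |\<in>| \<Gamma>") (auto simp: weights_finsert finsert_absorb)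

text \<open>The entailment points against the direction of the steps: it will pass on whatever
  \<alpha> entails to every component of \<gamma>. Quantifying over the side datum \<rho> makes the
  analysis available inside any larger datum.\<close>

definition analysable :: "'v datum \<Rightarrow> bool" where
  "analysable \<alpha> \<longleftrightarrow> (\<exists>\<gamma>. (\<forall>\<Delta>. \<Delta> |\<in>| \<gamma> \<longrightarrow> consistent_literals \<Delta> \<and> entails {|\<Delta>|} \<alpha>) \<and>
     (\<forall>\<rho>. analytic_step\<^sup>*\<^sup>* (\<alpha> |\<union>| \<rho>) (\<gamma> |\<union>| \<rho>)))"

lemma analysable_empty: "analysable {||}"
  unfolding analysable_def by (rule exI[of _ "{||}"]) auto

lemma analysable_union:
  assumes "analysable \<alpha>" and "analysable \<beta>"
  shows "analysable (\<alpha> |\<union>| \<beta>)"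
proof -
  from assms(1) obtain \<gamma> where
    g1: "\<And>\<Delta>. \<Delta> |\<in>| \<gamma> \<Longrightarrow> consistent_literals \<Delta> \<and> entails {|\<Delta>|} \<alpha>" and
    g2: "\<And>\<rho>. analytic_step\<^sup>*\<^sup>* (\<alpha> |\<union>| \<rho>) (\<gamma> |\<union>| \<rho>)"
    unfolding analysable_def by blast
  from assms(2) obtain \<delta> where
    d1: "\<And>\<Delta>. \<Delta> |\<in>| \<delta> \<Longrightarrow> consistent_literals \<Delta> \<and> entails {|\<Delta>|} \<beta>" and
    d2: "\<And>\<rho>. analytic_step\<^sup>*\<^sup>* (\<beta> |\<union>| \<rho>) (\<delta> |\<union>| \<rho>)"
    unfolding analysable_def by blast
  \<comment> \<open>First \<alpha> is analysed with \<beta> in its side datum, then \<beta> with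
    \<gamma> in its side datum.\<close>
  have "analytic_step\<^sup>*\<^sup>* ((\<alpha> |\<union>| \<beta>) |\<union>| \<rho>) ((\<gamma> |\<union>| \<delta>) |\<union>| \<rho>)" for \<rho>
    using rtranclp_trans[OF g2[of "\<beta> |\<union>| \<rho>"]] d2[of "\<gamma> |\<union>| \<rho>"]
    by (simp add: sup_assoc sup_left_commute)
  moreover have "consistent_literals \<Delta> \<and> entails {|\<Delta>|} (\<alpha> |\<union>| \<beta>)" if "\<Delta> |\<in>| \<gamma> |\<union>| \<delta>" for \<Delta>
    using that g1 d1 unfolding entails_def verifies_def funion_iff by metis
  ultimately show ?thesis unfolding analysable_def by blast
qed

text \<open>The components found for \<beta> are kept for \<alpha>, so they must entail \<alpha> as
  well; this is where invertibility of the step enters. The G-rules and \<open>NC\<close> are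
  invertible in this sense.\<close>

lemma analysable_step:
  assumes "\<And>\<rho>. analytic_step (\<alpha> |\<union>| \<rho>) (\<beta> |\<union>| \<rho>)" and "entails \<beta> \<alpha>" and "analysable \<beta>"
  shows "analysable \<alpha>"
  using assms unfolding analysable_def
  by (meson converse_rtranclp_into_rtranclp entails_trans)

lemma analysable_G:
  assumes "\<And>\<rho>. g_pair k (\<alpha> |\<union>| \<rho>) (\<beta> |\<union>| \<rho>)" and "entails \<beta> \<alpha>" and "analysable \<beta>"
  shows "analysable \<alpha>"
  using assms analysable_step analytic_step_G by blast

text \<open>A G-rule trades a non-literal for lighter formulas in every component it produces, so
  total weight drops. Once only literals remain, they are either consistent or contain a clash that
  \<open>NC\<close> removes.\<close>

lemma analysable_singleton: "analysable {|\<Gamma>|}"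
proof (induction "weights \<Gamma>" arbitrary: \<Gamma> rule: less_induct)
  case less
  show ?case
  proof (cases "\<forall>A. A |\<in>| \<Gamma> \<longrightarrow> literal A")
    case True
    show ?thesis
    proof (cases "consistent_literals \<Gamma>")
      case True
      then show ?thesis unfolding analysable_def
        by (intro exI[of _ "{|\<Gamma>|}"]) (auto simp: entails_def)
    next
      case False
      with True obtain p where "Var p |\<in>| \<Gamma>" "Neg (Var p) |\<in>| \<Gamma>"
        by (auto simp: consistent_literals_def)
      \<comment> \<open>\<open>NC\<close> is applied with overlap: its context is \<Gamma> itself,
        which already contains both clashing literals.\<close>
      then have "\<Gamma> = finsert (Var p) (finsert (Neg (Var p)) \<Gamma>)" by auto
      then have "analytic_step ({|\<Gamma>|} |\<union>| \<rho>) ({||} |\<union>| \<rho>)" for \<rho>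
        using analytic_step_NC[of "Var p" \<Gamma> \<rho>] by simp
      then show ?thesis
        by (rule analysable_step) (auto simp: entails_def verifies_def analysable_empty)
    qed
  next
    case False
    then obtain C where C: "C |\<in>| \<Gamma>" "\<not> literal C" by auto
    \<comment> \<open>Taking C out of the context ensures that the rule really eliminates it; with
      overlap C could survive and the weight would not drop.\<close>
    define \<Gamma>0 where "\<Gamma>0 = \<Gamma> |-| {|C|}"
    have \<Gamma>: "\<Gamma> = finsert C \<Gamma>0" and "C |\<notin>| \<Gamma>0" using C(1) by (auto simp: \<Gamma>0_def)
    then have w: "weights \<Gamma> = weight C + weights \<Gamma>0" by (simp add: weights_finsert)
    \<comment> \<open>The right sides of the G-rules have three shapes. Inserted formulas may
      already lie in \<Gamma>0, hence the use of the bound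
      \<open>weights_finsert_le\<close>.\<close>
    have one: "analysable {|finsert A \<Gamma>0|}" if "weight A < weight C" for A
      using that w weights_finsert_le[of A \<Gamma>0] by (intro less) simp
    have both: "analysable {|finsert A (finsert B \<Gamma>0)|}" if "weight A + weight B < weight C" for A B
      using that w weights_finsert_le[of A "finsert B \<Gamma>0"] weights_finsert_le[of B \<Gamma>0]
      by (intro less) simp
    have either: "analysable {|finsert A \<Gamma>0, finsert B \<Gamma>0|}"
      if "weight A < weight C" "weight B < weight C" for A B
      using analysable_union[OF one[OF that(1)] one[OF that(2)]] by (simp add: finsert_commute)
    show ?thesis
    proof (cases C)
      case (Var p)
      with C show ?thesis by simp
    next
      case (Con A B)
      show ?thesis
        by (rule analysable_G[where k = GCon and \<beta> = "{|finsert A (finsert B \<Gamma>0)|}"])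
          (auto simp: \<Gamma> Con entails_def verifies_def intro: g_pair.intros both)
    next
      case (Dis A B)
      show ?thesis
        by (rule analysable_G[where k = GDis and \<beta> = "{|finsert A \<Gamma>0, finsert B \<Gamma>0|}"])
          (auto simp: \<Gamma> Dis entails_def verifies_def intro: g_pair.intros either)
    next
      case (Neg D)
      show ?thesis
      proof (cases D)
        case (Var p)
        with C Neg show ?thesis by simp
      next
        case (Neg A)
        show ?thesis
          by (rule analysable_G[where k = GNegNeg and \<beta> = "{|finsert A \<Gamma>0|}"])
            (auto simp: \<Gamma> Neg \<open>C = Neg D\<close> entails_def verifies_def intro: g_pair.intros one)
      next
        case (Con A B)
        show ?thesis
          by (rule analysable_G[where k = GNegCon and
                \<beta> = "{|finsert (Neg A) \<Gamma>0, finsert (Neg B) \<Gamma>0|}"])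
            (auto simp: \<Gamma> Con \<open>C = Neg D\<close> entails_def verifies_def intro: g_pair.intros either)
      next
        case (Dis A B)
        show ?thesis
          by (rule analysable_G[where k = GNegDis and
                \<beta> = "{|finsert (Neg A) (finsert (Neg B) \<Gamma>0)|}"])
            (auto simp: \<Gamma> Dis \<open>C = Neg D\<close> entails_def verifies_def intro: g_pair.intros both)
      qed
    qed
  qed
qed

lemma analysable: "analysable \<alpha>"
proof (induction \<alpha>)
  case empty
  show ?case by (rule analysable_empty)
next
  case (insert \<Gamma> \<alpha>)
  then show ?case using analysable_union[OF analysable_singleton[of \<Gamma>]] by simp
qed

section \<open>Synthesis of verified formulas from the literals of an interpretation\<close>

definition literal_of :: "('v \<Rightarrow> bool) \<Rightarrow> 'v \<Rightarrow> 'v form" where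
  "literal_of I p = (if I p then Var p else Neg (Var p))"

definition signed :: "('v \<Rightarrow> bool) \<Rightarrow> 'v form \<Rightarrow> 'v form" where
  "signed I A = (if verifies_form I A then A else Neg A)"

lemma synthetic_finsert_G:
  assumes "synthetic_step\<^sup>*\<^sup>* \<alpha> \<beta>" and "g_pair k \<gamma> \<beta>"
  shows "synthetic_step\<^sup>*\<^sup>* \<alpha> \<gamma>"
  using assms by (meson rtranclp.rtrancl_into_rtrancl synthetic_step_G)

text \<open>A branching G-rule read synthetically needs two components: one is derived, the other is
  supplied for free by \<open>Exp\<close>. The two forms fit a derived left or right
  component.\<close>

lemma synthetic_Exp:
  assumes "synthetic_step\<^sup>*\<^sup>* \<alpha> (finsert \<Delta> \<rho>)"
  shows "synthetic_step\<^sup>*\<^sup>* \<alpha> (finsert \<Delta> (finsert \<Gamma> \<rho>))"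
    and "synthetic_step\<^sup>*\<^sup>* \<alpha> (finsert \<Gamma> (finsert \<Delta> \<rho>))"
  using rtranclp.rtrancl_into_rtrancl[OF assms synthetic_step_Exp[of _ \<Gamma>]]
  by (simp_all add: finsert_commute)

text \<open>A counterpart of Kalmar's lemma: the literals of \<open>I\<close> suffice to build
  whichever of A and its negation holds under \<open>I\<close>. Keeping \<Gamma> in the resulting
  component leaves the literals available for further formulas.\<close>

lemma synthetic_signed:
  assumes "\<And>p. p \<in> set_form A \<Longrightarrow> literal_of I p |\<in>| \<Gamma>"
  shows "synthetic_step\<^sup>*\<^sup>* (finsert \<Gamma> \<rho>) (finsert (finsert (signed I A) \<Gamma>) \<rho>)"
  using assms
proof (induction A arbitrary: \<Gamma> \<rho>)
  case (Var p)
  then have "signed I (Var p) |\<in>| \<Gamma>" by (auto simp: signed_def literal_of_def)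
  then show ?case by (simp add: finsert_absorb)
next
  case (Neg A)
  have "synthetic_step\<^sup>*\<^sup>* (finsert \<Gamma> \<rho>) (finsert (finsert (signed I A) \<Gamma>) \<rho>)"
    using Neg by simp
  \<comment> \<open>If \<open>I\<close> verifies A, one \<open>GNegNeg\<close> step adds the double
    negation; otherwise the signed forms of A and \<open>Neg A\<close> coincide.\<close>
  then show ?case
    by (auto simp: signed_def intro: synthetic_finsert_G[OF _ g_pair.intros(3)])
next
  case (Con A B)
  have A: "synthetic_step\<^sup>*\<^sup>* (finsert \<Gamma> \<rho>) (finsert (finsert (signed I A) \<Gamma>) \<rho>)"
    and B: "synthetic_step\<^sup>*\<^sup>* (finsert \<Gamma> \<rho>) (finsert (finsert (signed I B) \<Gamma>) \<rho>)"
    using Con by simp_all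
  \<comment> \<open>The induction hypothesis for A is applied to the component already enlarged by
    the signed form of B, hence \<Gamma> is arbitrary in the induction.\<close>
  have AB: "synthetic_step\<^sup>*\<^sup>* (finsert \<Gamma> \<rho>)
      (finsert (finsert (signed I A) (finsert (signed I B) \<Gamma>)) \<rho>)"
    using B by (rule rtranclp_trans) (use Con in simp)
  \<comment> \<open>One refuted conjunct is enough: the component with the other negation comes from
    \<open>Exp\<close>, and \<open>GNegCon\<close> merges the two.\<close>
  consider "verifies_form I A" "verifies_form I B" | "\<not> verifies_form I A" | "\<not> verifies_form I B"
    by blast
  then show ?case
  proof cases
    case 1
    with AB show ?thesis by (auto simp: signed_def intro: synthetic_finsert_G[OF _ g_pair.intros(1)])
  next
    case 2
    with synthetic_Exp(1)[OF A, of "finsert (Neg B) \<Gamma>"] show ?thesis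
      by (auto simp: signed_def intro: synthetic_finsert_G[OF _ g_pair.intros(5)])
  next
    case 3
    with synthetic_Exp(2)[OF B, of "finsert (Neg A) \<Gamma>"] show ?thesis
      by (auto simp: signed_def intro: synthetic_finsert_G[OF _ g_pair.intros(5)])
  qed
next
  case (Dis A B)
  have A: "synthetic_step\<^sup>*\<^sup>* (finsert \<Gamma> \<rho>) (finsert (finsert (signed I A) \<Gamma>) \<rho>)"
    and B: "synthetic_step\<^sup>*\<^sup>* (finsert \<Gamma> \<rho>) (finsert (finsert (signed I B) \<Gamma>) \<rho>)"
    using Dis by simp_all
  have AB: "synthetic_step\<^sup>*\<^sup>* (finsert \<Gamma> \<rho>)
      (finsert (finsert (signed I A) (finsert (signed I B) \<Gamma>)) \<rho>)"
    using B by (rule rtranclp_trans) (use Dis in simp)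
  \<comment> \<open>Dually, one verified disjunct is enough, while two refuted ones are joined by
    \<open>GNegDis\<close>.\<close>
  consider "\<not> verifies_form I A" "\<not> verifies_form I B" | "verifies_form I A" | "verifies_form I B"
    by blast
  then show ?case
  proof cases
    case 1
    with AB show ?thesis by (auto simp: signed_def intro: synthetic_finsert_G[OF _ g_pair.intros(4)])
  next
    case 2
    with synthetic_Exp(1)[OF A, of "finsert B \<Gamma>"] show ?thesis
      by (auto simp: signed_def intro: synthetic_finsert_G[OF _ g_pair.intros(2)])
  next
    case 3
    with synthetic_Exp(2)[OF B, of "finsert A \<Gamma>"] show ?thesis
      by (auto simp: signed_def intro: synthetic_finsert_G[OF _ g_pair.intros(2)])
  qed
qed

text \<open>The formulas of \<Delta> are added to \<Gamma> one by one, each being its own signed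
  form because \<open>I\<close> verifies it; a single \<open>Del\<close> then discards
  \<Gamma>.\<close>

lemma synthetic_component:
  assumes "\<And>A p. A |\<in>| \<Delta> \<Longrightarrow> p \<in> set_form A \<Longrightarrow> literal_of I p |\<in>| \<Gamma>"
    and "\<And>A. A |\<in>| \<Delta> \<Longrightarrow> verifies_form I A"
  shows "synthetic_step\<^sup>*\<^sup>* (finsert \<Gamma> \<rho>) (finsert \<Delta> \<rho>)"
proof -
  have "synthetic_step\<^sup>*\<^sup>* (finsert \<Gamma> \<rho>) (finsert (\<Delta> |\<union>| \<Gamma>) \<rho>)"
    using assms
  proof (induction \<Delta>)
    case empty
    show ?case by simp
  next
    case (insert A \<Delta>)
    have "synthetic_step\<^sup>*\<^sup>* (finsert (\<Delta> |\<union>| \<Gamma>) \<rho>) (finsert (finsert (signed I A) (\<Delta> |\<union>| \<Gamma>)) \<rho>)"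
      using insert.prems(1)[of A] by (intro synthetic_signed) auto
    moreover have "signed I A = A" using insert.prems(2)[of A] by (simp add: signed_def)
    ultimately have "synthetic_step\<^sup>*\<^sup>* (finsert (\<Delta> |\<union>| \<Gamma>) \<rho>) (finsert (finsert A \<Delta> |\<union>| \<Gamma>) \<rho>)"
      by simp
    moreover have "synthetic_step\<^sup>*\<^sup>* (finsert \<Gamma> \<rho>) (finsert (\<Delta> |\<union>| \<Gamma>) \<rho>)"
      using insert.prems by (intro insert.IH) auto
    ultimately show ?case by (metis rtranclp_trans)
  qed
  then show ?thesis by (rule rtranclp.rtrancl_into_rtrancl) (rule synthetic_step_Del)
qed

section \<open>Absorption of literal components into a datum that they entail\<close>

definition variables :: "'v datum \<Rightarrow> 'v set" where
  "variables \<beta> = (\<Union>\<Delta> \<in> fset \<beta>. \<Union>A \<in> fset \<Delta>. set_form A)"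

lemma finite_set_form: "finite (set_form A)"
  by (induction A) auto

lemma finite_variables: "finite (variables \<beta>)"
  by (auto simp: variables_def finite_set_form)

lemma consistent_literals_Var:
  assumes "consistent_literals \<Gamma>" and "Neg (Var p) |\<notin>| \<Gamma>"
  shows "consistent_literals (finsert (Var p) \<Gamma>)"
  using assms by (auto simp: consistent_literals_def)

lemma consistent_literals_Neg:
  assumes "consistent_literals \<Gamma>" and "Var p |\<notin>| \<Gamma>"
  shows "consistent_literals (finsert (Neg (Var p)) \<Gamma>)"
  using assms by (auto simp: consistent_literals_def)

text \<open>Induction on the number of variables of \<beta> that \<Gamma> leaves undecided. The side
  datum \<rho> varies because it must hold one half of an \<open>EM\<close> split while the other
  half is absorbed.\<close>

lemma synthetic_absorb:
  assumes "consistent_literals \<Gamma>" and "entails {|\<Gamma>|} \<beta>"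
  shows "synthetic_step\<^sup>*\<^sup>* (finsert \<Gamma> (\<rho> |\<union>| \<beta>)) (\<rho> |\<union>| \<beta>)"
  using assms
proof (induction "card {p \<in> variables \<beta>. Var p |\<notin>| \<Gamma> \<and> Neg (Var p) |\<notin>| \<Gamma>}"
    arbitrary: \<Gamma> \<rho> rule: less_induct)
  case less
  let ?U = "\<lambda>\<Gamma>. {p \<in> variables \<beta>. Var p |\<notin>| \<Gamma> \<and> Neg (Var p) |\<notin>| \<Gamma>}"
  show ?case
  proof (cases "?U \<Gamma> = {}")
    case True
    \<comment> \<open>The interpretation is read off from \<Gamma>. Variables on which \<Gamma> is
      silent are false by default; in this case none of them occurs in \<beta>.\<close>
    define I where "I p \<longleftrightarrow> Var p |\<in>| \<Gamma>" for p
    have "verifies_form I A" if "A |\<in>| \<Gamma>" for A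
    proof -
      have "literal A" using less.prems(1) that by (simp add: consistent_literals_def)
      then show ?thesis using less.prems(1) that
        by (cases A rule: literal.cases) (auto simp: I_def consistent_literals_def)
    qed
    then have "verifies I {|\<Gamma>|}" by (auto simp: verifies_def)
    then obtain \<Delta> where \<Delta>: "\<Delta> |\<in>| \<beta>" "\<And>A. A |\<in>| \<Delta> \<Longrightarrow> verifies_form I A"
      using less.prems(2) by (auto simp: entails_def verifies_def)
    \<comment> \<open>Every variable of \<beta> is decided by \<Gamma>, so if \<open>I\<close> makes
      p false then \<open>Neg (Var p)\<close> must be in \<Gamma>.\<close>
    have "literal_of I p |\<in>| \<Gamma>" if "A |\<in>| \<Delta>" "p \<in> set_form A" for A p
    proof -
      have "p \<in> variables \<beta>" using that \<Delta>(1) by (auto simp: variables_def)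
      with True show ?thesis by (auto simp: literal_of_def I_def)
    qed
    then have "synthetic_step\<^sup>*\<^sup>* (finsert \<Gamma> (\<rho> |\<union>| \<beta>)) (finsert \<Delta> (\<rho> |\<union>| \<beta>))"
      using \<Delta>(2) by (rule synthetic_component)
    with \<Delta>(1) show ?thesis by (simp add: finsert_absorb)
  next
    case False
    then obtain p where p: "p \<in> variables \<beta>" "Var p |\<notin>| \<Gamma>" "Neg (Var p) |\<notin>| \<Gamma>" by auto
    \<comment> \<open>Adding either literal of the undecided p keeps consistency, preserves the
      entailment by enlarging the component, and removes p from the undecided variables.\<close>
    have absorb: "synthetic_step\<^sup>*\<^sup>* (finsert (finsert L \<Gamma>) (\<rho>' |\<union>| \<beta>)) (\<rho>' |\<union>| \<beta>)"
      if "L = Var p \<or> L = Neg (Var p)" for L \<rho>'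
    proof (rule less.hyps)
      show "card (?U (finsert L \<Gamma>)) < card (?U \<Gamma>)"
      proof (rule psubset_card_mono)
        show "finite (?U \<Gamma>)" by (simp add: finite_variables)
        have "p \<in> ?U \<Gamma>" "p \<notin> ?U (finsert L \<Gamma>)" using p that by auto
        then show "?U (finsert L \<Gamma>) \<subset> ?U \<Gamma>" by blast
      qed
      show "consistent_literals (finsert L \<Gamma>)"
        using that
      proof
        assume "L = Var p"
        with less.prems(1) p(3) show ?thesis by (simp add: consistent_literals_Var)
      next
        assume "L = Neg (Var p)"
        with less.prems(1) p(2) show ?thesis by (simp add: consistent_literals_Neg)
      qed
      show "entails {|finsert L \<Gamma>|} \<beta>"
        by (rule entails_trans[OF entails_singleton_mono less.prems(2)]) auto
    qed
    have "synthetic_step\<^sup>*\<^sup>* (finsert \<Gamma> (\<rho> |\<union>| \<beta>))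
        (finsert (finsert (Var p) \<Gamma>) (finsert (finsert (Neg (Var p)) \<Gamma>) (\<rho> |\<union>| \<beta>)))"
      using synthetic_step_EM by (rule r_into_rtranclp)
    \<comment> \<open>The positive half is absorbed with the negative half placed in the side
      datum.\<close>
    also have "synthetic_step\<^sup>*\<^sup>* \<dots> (finsert (finsert (Neg (Var p)) \<Gamma>) (\<rho> |\<union>| \<beta>))"
      using absorb[of "Var p" "finsert (finsert (Neg (Var p)) \<Gamma>) \<rho>"] by simp
    also have "synthetic_step\<^sup>*\<^sup>* \<dots> (\<rho> |\<union>| \<beta>)"
      using absorb by simp
    finally show ?thesis .
  qed
qed

lemma synthetic_absorb_all:
  assumes "\<And>\<Gamma>. \<Gamma> |\<in>| \<gamma> \<Longrightarrow> consistent_literals \<Gamma> \<and> entails {|\<Gamma>|} \<beta>"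
  shows "synthetic_step\<^sup>*\<^sup>* (\<gamma> |\<union>| \<beta>) \<beta>"
  using assms
proof (induction \<gamma>)
  case empty
  show ?case by simp
next
  case (insert \<Gamma> \<gamma>)
  have "synthetic_step\<^sup>*\<^sup>* (finsert \<Gamma> (\<gamma> |\<union>| \<beta>)) (\<gamma> |\<union>| \<beta>)"
    using insert.prems by (intro synthetic_absorb) auto
  also have "synthetic_step\<^sup>*\<^sup>* \<dots> \<beta>"
    using insert.prems by (intro insert.IH) auto
  finally show ?case by simp
qed

lemma synthetic_Exp_all: "synthetic_step\<^sup>*\<^sup>* \<gamma> (\<beta> |\<union>| \<gamma>)"
proof (induction \<beta>)
  case empty
  show ?case by simp
next
  case (insert \<Gamma> \<beta>)
  from rtranclp.rtrancl_into_rtrancl[OF insert.IH synthetic_step_Exp] show ?case by simp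
qed

section \<open>From chains of steps to deductions\<close>

lemma rtranclp_successively:
  assumes "R\<^sup>*\<^sup>* x y"
  shows "\<exists>xs. successively R (xs @ [y]) \<and> hd (xs @ [y]) = x"
  using assms
proof (induction rule: converse_rtranclp_induct)
  case base
  show ?case by (rule exI[of _ "[]"]) simp
next
  case (step x z)
  then obtain xs where "successively R (xs @ [y])" "hd (xs @ [y]) = z" by blast
  with step(1) show ?case
    by (intro exI[of _ "x # xs"]) (auto simp: successively_Cons)
qed

lemma licensed_by_mono: "licensed_by R ds \<Longrightarrow> R \<subseteq> S \<Longrightarrow> licensed_by S ds"
  unfolding licensed_by_def by (erule successively_mono) auto

theorem mainTheorem1:
  fixes \<alpha> \<beta> :: "'v datum"
  assumes "entails \<alpha> \<beta>"
  shows "(\<exists>ds. deduction \<alpha> ds \<beta> \<and> quasi_normal ds) \<and>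
         (\<exists>ds. deduction \<alpha> ds \<beta> \<and> quasi_normal ds \<and> quasi_normal_without_Exp ds)"
proof -
  obtain \<gamma> where \<gamma>: "\<And>\<Delta>. \<Delta> |\<in>| \<gamma> \<Longrightarrow> consistent_literals \<Delta> \<and> entails {|\<Delta>|} \<alpha>"
    and "\<And>\<rho>. analytic_step\<^sup>*\<^sup>* (\<alpha> |\<union>| \<rho>) (\<gamma> |\<union>| \<rho>)"
    using analysable[of \<alpha>] unfolding analysable_def by blast
  from this(2)[of "{||}"] have "analytic_step\<^sup>*\<^sup>* \<alpha> \<gamma>" by simp
  from rtranclp_successively[OF this]
  obtain xs where xs: "successively analytic_step (xs @ [\<gamma>])" "hd (xs @ [\<gamma>]) = \<alpha>"
    by blast
  \<comment> \<open>The assumption enters here: each component of \<gamma> entails \<alpha> and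
    therefore \<beta>.\<close>
  have "synthetic_step\<^sup>*\<^sup>* (\<gamma> |\<union>| \<beta>) \<beta>"
    using \<gamma> entails_trans[OF _ assms] by (intro synthetic_absorb_all) blast
  with synthetic_Exp_all[of \<gamma> \<beta>] have "synthetic_step\<^sup>*\<^sup>* \<gamma> \<beta>"
    unfolding sup_commute[of \<beta> \<gamma>] by (rule rtranclp_trans)
  from rtranclp_successively[OF this]
  obtain zs where zs: "successively synthetic_step (zs @ [\<beta>])" "hd (zs @ [\<beta>]) = \<gamma>"
    by blast
  \<comment> \<open>The synthetic list is rewritten to display its head \<gamma>, the datum it
    shares with the analytic list.\<close>
  from zs(2) obtain ys where ys: "zs @ [\<beta>] = \<gamma> # ys" by (metis list.collapse snoc_eq_iff_butlast)
  have ana: "licensed_by ((analytic_rules \<union> S_rules) - {Exp}) (xs @ [\<gamma>])"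
    using xs(1) unfolding licensed_by_def analytic_step_def .
  have syn: "licensed_by (synthetic_rules \<union> S_rules) (\<gamma> # ys)"
    using zs(1) ys unfolding licensed_by_def synthetic_step_def by simp
  have "licensed_by UNIV (xs @ [\<gamma>])" "licensed_by UNIV (\<gamma> # ys)"
    using ana syn licensed_by_mono by blast+
  \<comment> \<open>Since both lists contain \<gamma> at the junction, joining them creates no new
    step to be licensed.\<close>
  then have "licensed_by UNIV (xs @ \<gamma> # ys)"
    by (auto simp: licensed_by_def successively_append_iff)
  moreover have "last (xs @ \<gamma> # ys) = \<beta>" by (metis last_appendR last_snoc ys list.distinct(1))
  moreover have "hd (xs @ \<gamma> # ys) = \<alpha>" using xs(2) by (cases xs) auto
  ultimately have "deduction \<alpha> (xs @ \<gamma> # ys) \<beta>" by (simp add: deduction_def)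
  moreover have "quasi_normal_without_Exp (xs @ \<gamma> # ys)"
    using ana syn unfolding quasi_normal_without_Exp_def quasi_synthetic_def by blast
  moreover have "quasi_normal (xs @ \<gamma> # ys)"
    using licensed_by_mono[OF ana] syn
    unfolding quasi_normal_def quasi_analytic_def quasi_synthetic_def by blast
  ultimately show ?thesis by blast
qed

end
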